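(* Let $F:\mathbb{R}^d\to\mathbb{R}^d$ be $L$-Lipschitz and $\mu$-quasi strongly monotone with $\mu>0$, i.e. $\langle F(x),x-x^*\rangle\ge\mu\|x-x^*\|^2$ for all $x\in\mathbb{R}^d$, where $x^*$ is the unique point with $F(x^* )=0$. Assume the stochastic estimators satisfy $\mathbb{E}_\xi[F_\xi(x)]=F(x)$ and $\mathbb{E}_\xi[\|F_\xi(x)-F(x)\|^2]\le\delta\|x-x^*\|^2+\sigma^2$ for all $x\in\mathbb{R}^d$, with $\delta,\sigma\ge0$. Let $\gamma_2=\alpha\gamma_1$, $0<\alpha\le\frac14$, and let $\gamma_1=\gamma>0$ satisfy $$\gamma\le\min\left\{\frac{\mu b}{18\delta},\ \frac{1}{4\mu+\sqrt{6(L^2+\delta/b)}}\right\}.$$ Then for all $K\ge 0$ the iterates of I-SEG with batchsize $b$ satisfy $$\mathbb{E}\left[\|x^K-x^*\|^2\right]\le\left(1-\frac{\alpha\gamma\mu}{8}\right)^K\|x^0-x^*\|^2+\frac{48(\alpha+1)\gamma\sigma^2}{\mu b}.$$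
   Context: $\|\cdot\|$ is the Euclidean norm. Independent-samples stochastic extragradient (I-SEG) with batchsize $b\ge1$, started at a deterministic $x^0\in\mathbb{R}^d$, is $$x^{k+1}=x^k-\gamma_2F_{\xi_2^k}\left(x^k-\gamma_1F_{\xi_1^k}(x^k)\right),\quad k\ge0,$$ with mini-batched estimators $$F_{\xi_1^k}(x^k)=\frac1b\sum_{i=1}^bF_{\xi_1^k(i)}(x^k),\qquad F_{\xi_2^k}\left(x^k-\gamma_1F_{\xi_1^k}(x^k)\right)=\frac1b\sum_{i=1}^bF_{\xi_2^k(i)}\left(x^k-\gamma_1F_{\xi_1^k}(x^k)\right),$$ where all samples $\xi_1^k(1),\dots,\xi_1^k(b),\xi_2^k(1),\dots,\xi_2^k(b)$, $k\ge0$, are i.i.d. copies of $\xi$. When $\delta=0$ the term $\mu b/(18\delta)$ is read as $+\infty$. *)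

theory Defs
  imports "HOL-Probability.Probability"
begin

definition quasi_strongly_monotone ::
    "real \<Rightarrow> (real ^ 'd \<Rightarrow> real ^ 'd) \<Rightarrow> real ^ 'd \<Rightarrow> bool" where
  "quasi_strongly_monotone \<mu> F xs \<longleftrightarrow>
     (\<forall>x. F x \<bullet> (x - xs) \<ge> \<mu> * (norm (x - xs))\<^sup>2)"

definition minibatch ::
    "('s \<Rightarrow> real ^ 'd \<Rightarrow> real ^ 'd) \<Rightarrow> nat \<Rightarrow> (nat \<Rightarrow> 's) \<Rightarrow> real ^ 'd \<Rightarrow> real ^ 'd" where
  "minibatch G b z x = (1 / real b) *\<^sub>R (\<Sum>i = 1..b. G (z i) x)"

text \<open>
  One realisation of I-SEG: \<open>z 1 k i\<close> and \<open>z 2 k i\<close> are the values of the samples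
  $\xi_1^k(i)$ and $\xi_2^k(i)$.
\<close>

primrec iseg ::
    "('s \<Rightarrow> real ^ 'd \<Rightarrow> real ^ 'd) \<Rightarrow> nat \<Rightarrow> real \<Rightarrow> real \<Rightarrow> real ^ 'd \<Rightarrow>
     (nat \<Rightarrow> nat \<Rightarrow> nat \<Rightarrow> 's) \<Rightarrow> nat \<Rightarrow> real ^ 'd" where
  "iseg G b \<gamma>1 \<gamma>2 x0 z 0 = x0"
| "iseg G b \<gamma>1 \<gamma>2 x0 z (Suc k) =
     (let x = iseg G b \<gamma>1 \<gamma>2 x0 z k;
          y = x - \<gamma>1 *\<^sub>R minibatch G b (z 1 k) x
      in x - \<gamma>2 *\<^sub>R minibatch G b (z 2 k) y)"

text \<open>
  All samples of stages 1 and 2, all iterations, and all batch positions \<open>1..b\<close> are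
  jointly independent with common law \<open>D\<close>; \<open>D\<close> also carries the measurable structure
  of the sample space.
\<close>

definition iid_samples ::
    "'w measure \<Rightarrow> 's measure \<Rightarrow> nat \<Rightarrow> (nat \<Rightarrow> nat \<Rightarrow> nat \<Rightarrow> 'w \<Rightarrow> 's) \<Rightarrow> bool" where
  "iid_samples M D b \<xi> \<longleftrightarrow>
     prob_space.indep_vars M (\<lambda>_. D) (\<lambda>(j, k, i). \<xi> j k i) ({1, 2} \<times> UNIV \<times> {1..b}) \<and>
     (\<forall>j\<in>{1, 2}. \<forall>k. \<forall>i\<in>{1..b}. distr M D (\<xi> j k i) = D)"

text \<open>
  Integrability is part of each moment condition because the Bochner integral of a
  non-integrable function is 0. Joint measurability of the estimator in sample and point
  makes the iterates random variables.
\<close>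

definition stochastic_estimator ::
    "'s measure \<Rightarrow> ('s \<Rightarrow> real ^ 'd \<Rightarrow> real ^ 'd) \<Rightarrow> (real ^ 'd \<Rightarrow> real ^ 'd) \<Rightarrow>
     real ^ 'd \<Rightarrow> real \<Rightarrow> real \<Rightarrow> bool" where
  "stochastic_estimator D G F xs \<delta> \<sigma> \<longleftrightarrow>
     (\<lambda>(s, x). G s x) \<in> borel_measurable (D \<Otimes>\<^sub>M borel) \<and>
     (\<forall>x. integrable D (\<lambda>s. G s x) \<and> (\<integral>s. G s x \<partial>D) = F x) \<and>
     (\<forall>x. integrable D (\<lambda>s. (norm (G s x - F x))\<^sup>2) \<and>
          (\<integral>s. (norm (G s x - F x))\<^sup>2 \<partial>D) \<le> \<delta> * (norm (x - xs))\<^sup>2 + \<sigma>\<^sup>2)"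

end

theory Submission imports Defs begin

text \<open>
  Write \<open>r = \<parallel>x - p\<parallel>\<^sup>2\<close>, where \<open>p\<close> is the zero of \<open>F\<close>, let \<open>g\<close> be the first estimate, \<open>y = x - \<gamma> g\<close> the
  half step and \<open>a = \<alpha> \<gamma>\<close> the outer step size. The second batch is independent of \<open>x\<close> and \<open>y\<close>, so
  averaging over it gives
  \<open>r - 2 a (F y \<bullet> (x - p)) + a\<^sup>2 \<parallel>F y\<parallel>\<^sup>2\<close> plus \<open>a\<^sup>2\<close> times the variance of the second estimate at \<open>y\<close>.

  The middle term splits as \<open>F y \<bullet> (y - p) + \<gamma> (F y \<bullet> g)\<close>. Quasi strong monotonicity bounds the first part
  below by \<open>\<mu> \<parallel>y - p\<parallel>\<^sup>2\<close>. Polarisation turns twice the second part into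
  \<open>\<parallel>F y\<parallel>\<^sup>2 + \<parallel>g\<parallel>\<^sup>2 - \<parallel>F y - g\<parallel>\<^sup>2\<close>: its first square absorbs \<open>a\<^sup>2 \<parallel>F y\<parallel>\<^sup>2\<close> because \<open>a \<le> \<gamma>\<close>,
  and its last square is, by Lipschitz continuity, at most \<open>\<parallel>g\<parallel>\<^sup>2 / 3\<close> plus twice the squared error of the
  first estimate. What remains of \<open>\<parallel>g\<parallel>\<^sup>2\<close> pays for the passage from \<open>\<parallel>y - p\<parallel>\<^sup>2\<close> back to \<open>r / 2\<close>. This is
  \<open>extragradient_step_ineq\<close>, an inequality with no randomness left in it.

  Averaging over the first batch replaces the squared error by its bound \<open>(\<delta> r + \<sigma>\<^sup>2) / b\<close>, and the
  condition \<open>18 \<delta> \<gamma> \<le> \<mu> b\<close> makes the \<open>\<delta>\<close>-part of this a small fraction of \<open>\<mu> r\<close> after multiplication by \<open>\<gamma>\<close>. Hence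
  \<open>E r\<^sub>k\<^sub>+\<^sub>1 \<le> (1 - \<alpha> \<gamma> \<mu> / 8) E r\<^sub>k + \<alpha> \<gamma>\<^sup>2 (2 + \<alpha>) \<sigma>\<^sup>2 / b\<close> (\<open>extragradient_expected_step\<close>), a linear
  recursion whose fixed point \<open>8 (2 + \<alpha>) \<gamma> \<sigma>\<^sup>2 / (\<mu> b)\<close> is below the stated noise term.

  Both averagings are instances of \<open>nn_integral_indep_copy\<close>. Expectations are carried as integrals of
  nonnegative extended reals until the end, so that integrability of the iterates is a consequence of
  the recursion instead of a side condition in each of its steps.
\<close>

section \<open>One step for a fixed first estimate\<close>

text \<open>
  The terms in \<open>\<delta>\<close> and \<open>v\<close> are the variance allowed to the second estimate at the half step. The error of
  the first estimate \<open>g\<close> appears on the right as a square, ready to be averaged; no cross term in it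
  survives, since \<open>\<parallel>F y - g\<parallel>\<^sup>2\<close> is split by the parallelogram inequality.
\<close>

lemma extragradient_step_ineq:
  fixes F :: "'a::real_inner \<Rightarrow> 'a"
  assumes lip: "norm (F x - F (x - \<gamma> *\<^sub>R g)) \<le> L * norm (\<gamma> *\<^sub>R g)"
    and mon: "F (x - \<gamma> *\<^sub>R g) \<bullet> (x - \<gamma> *\<^sub>R g - p) \<ge> \<mu> * (norm (x - \<gamma> *\<^sub>R g - p))\<^sup>2"
    and pos: "\<gamma> > 0" "\<mu> > 0" "0 < \<alpha>" "\<alpha> \<le> 1 / 4" "\<delta> \<ge> 0" "L \<ge> 0"
    and step_lip: "6 * L\<^sup>2 * \<gamma>\<^sup>2 \<le> 1" and step_mon: "4 * \<gamma> * \<mu> \<le> 1" and step_noise: "18 * \<delta> * \<gamma> \<le> \<mu>"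
  shows "(norm (x - p - (\<alpha> * \<gamma>) *\<^sub>R F (x - \<gamma> *\<^sub>R g)))\<^sup>2
            + (\<alpha> * \<gamma>)\<^sup>2 * (\<delta> * (norm (x - \<gamma> *\<^sub>R g - p))\<^sup>2 + v)
         \<le> (1 - 143 / 144 * (\<alpha> * \<gamma> * \<mu>)) * (norm (x - p))\<^sup>2
            + 2 * \<alpha> * \<gamma>\<^sup>2 * (norm (g - F x))\<^sup>2 + (\<alpha> * \<gamma>)\<^sup>2 * v"
proof -
  define y where "y = x - \<gamma> *\<^sub>R g"
  define q where "q = (norm g)\<^sup>2"
  define s where "s = (norm (F y))\<^sup>2"
  define r where "r = (norm (x - p))\<^sup>2"
  define t where "t = (norm (y - p))\<^sup>2"
  define e where "e = (norm (g - F x))\<^sup>2"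
  have nonneg: "q \<ge> 0" "s \<ge> 0" "t \<ge> 0"
    by (simp_all add: q_def s_def t_def)
  \<comment> \<open>Monotonicity at the half step controls \<open>F y \<bullet> (y - p)\<close>, and \<open>x - p = (y - p) + \<gamma> g\<close>
    leaves \<open>F y \<bullet> g\<close>, which polarisation turns into squares below.\<close>
  have expand: "(norm (x - p - (\<alpha> * \<gamma>) *\<^sub>R F y))\<^sup>2
      = r - 2 * (\<alpha> * \<gamma>) * (F y \<bullet> (y - p) + \<gamma> * (F y \<bullet> g)) + (\<alpha> * \<gamma>)\<^sup>2 * s"
    unfolding r_def s_def y_def power2_norm_eq_inner
    by (simp add: inner_diff_left inner_diff_right inner_commute power2_eq_square algebra_simps)
  have split: "(norm (u + w))\<^sup>2 \<le> 2 * (norm u)\<^sup>2 + 2 * (norm w)\<^sup>2" for u w :: 'a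
  proof -
    have "(norm (u + w))\<^sup>2 + (norm (u - w))\<^sup>2 = 2 * (norm u)\<^sup>2 + 2 * (norm w)\<^sup>2"
      by (simp add: power2_norm_eq_inner inner_diff_left inner_diff_right inner_add_left
          inner_add_right inner_commute)
    then show ?thesis
      using zero_le_power2[of "norm (u - w)"] by linarith
  qed
  have "(norm (F x - F y))\<^sup>2 \<le> (L * norm (\<gamma> *\<^sub>R g))\<^sup>2"
    using lip unfolding y_def by (intro power_mono) auto
  also have "\<dots> = L\<^sup>2 * \<gamma>\<^sup>2 * q"
    by (simp add: q_def power_mult_distrib)
  also have "\<dots> \<le> 1 / 6 * q"
    using step_lip nonneg by (intro mult_right_mono) auto
  finally have lip_sq: "(norm (F x - F y))\<^sup>2 \<le> 1 / 6 * q" .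
  have "(norm (g - F y))\<^sup>2 \<le> 2 * e + 1 / 3 * q"
    using split[of "g - F x" "F x - F y"] lip_sq by (simp add: e_def)
  moreover have "2 * (F y \<bullet> g) = s + q - (norm (g - F y))\<^sup>2"
    by (simp add: s_def q_def power2_norm_eq_inner inner_diff_left inner_diff_right inner_commute)
  ultimately have cross: "2 * (F y \<bullet> g) \<ge> s + 2 / 3 * q - 2 * e"
    by linarith
  have "r \<le> 2 * t + 2 * (\<gamma>\<^sup>2 * q)"
    using split[of "y - p" "\<gamma> *\<^sub>R g"]
    by (simp add: r_def t_def y_def q_def power_mult_distrib)
  then have far: "t \<ge> r / 2 - \<gamma>\<^sup>2 * q"
    by linarith
  have mon': "F y \<bullet> (y - p) \<ge> \<mu> * t"
    using mon by (simp add: y_def t_def)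
  define a where "a = \<alpha> * \<gamma>"
  have a: "a > 0" "a \<le> \<gamma> / 4"
    using pos by (simp_all add: a_def)
  have m1: "a * (2 * (F y \<bullet> (y - p))) \<ge> a * (2 * \<mu> * t)"
    using mon' a by (intro mult_left_mono) auto
  have m2: "a * \<gamma> * (2 * (F y \<bullet> g)) \<ge> a * \<gamma> * (s + 2 / 3 * q - 2 * e)"
    using cross a pos by (intro mult_left_mono) auto
  \<comment> \<open>Since \<open>a \<le> \<gamma>\<close>, the terms in \<open>s\<close> have a nonpositive sum and can be dropped; the surplus
    \<open>2 q / 3\<close> of \<open>m2\<close> then pays for replacing \<open>t\<close> by \<open>r / 2 - \<gamma>\<^sup>2 q\<close>.\<close>
  have m3: "a * a * s \<le> a * \<gamma> * s"
    using a pos nonneg by (intro mult_right_mono mult_left_mono) auto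
  have "a * \<delta> \<le> \<gamma> / 4 * \<delta>"
    using a pos by (intro mult_right_mono) auto
  also have "\<dots> \<le> \<mu> / 72"
    using step_noise by (simp add: algebra_simps)
  finally have "a * \<delta> \<le> \<mu> / 72" .
  then have m4: "a * (a * \<delta>) * t \<le> a * (\<mu> / 72) * t"
    using a nonneg by (intro mult_right_mono mult_left_mono) auto
  \<comment> \<open>After \<open>m4\<close> the coefficient of \<open>t\<close> is \<open>- a * \<mu> * (2 - 1 / 72)\<close>, and \<open>2 - 1 / 72 = 143 / 72\<close>.\<close>
  have m5: "a * \<mu> * (143 / 72) * t \<ge> a * \<mu> * (143 / 72) * (r / 2 - \<gamma>\<^sup>2 * q)"
    using far a pos by (intro mult_left_mono) auto
  have "a * \<gamma> * q * (143 / 72 * (\<gamma> * \<mu>)) \<le> a * \<gamma> * q * (2 / 3)"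
    using step_mon a pos nonneg by (intro mult_left_mono) auto
  then have m6: "a * \<mu> * (143 / 72) * (\<gamma>\<^sup>2 * q) \<le> a * \<gamma> * (2 / 3 * q)"
    by (simp add: power2_eq_square algebra_simps)
  have "r - 2 * a * (F y \<bullet> (y - p) + \<gamma> * (F y \<bullet> g)) + a\<^sup>2 * s + a\<^sup>2 * (\<delta> * t + v)
      \<le> (1 - 143 / 144 * (a * \<mu>)) * r + 2 * (a * \<gamma>) * e + a\<^sup>2 * v"
    using m1 m2 m3 m4 m5 m6 by (simp add: power2_eq_square algebra_simps)
  then show ?thesis
    using expand by (simp add: a_def r_def t_def e_def y_def power2_eq_square algebra_simps)
qed

section \<open>Independence and second moments\<close>

text \<open>
  In contrast to \<open>indep_var\<close>, the two variables may have different value types: below, a point of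
  Euclidean space is independent of a batch of samples.
\<close>

definition (in prob_space) indep_rv ::
    "'s measure \<Rightarrow> ('a \<Rightarrow> 's) \<Rightarrow> 't measure \<Rightarrow> ('a \<Rightarrow> 't) \<Rightarrow> bool" where
  "indep_rv S X T Y \<longleftrightarrow> random_variable S X \<and> random_variable T Y \<and>
     distr M S X \<Otimes>\<^sub>M distr M T Y = distr M (S \<Otimes>\<^sub>M T) (\<lambda>\<omega>. (X \<omega>, Y \<omega>))"

lemma (in prob_space) indep_rv_compose:
  assumes ind: "indep_var S X T Y"
    and f: "f \<in> measurable S S'" and g: "g \<in> measurable T T'"
  shows "indep_rv S' (\<lambda>\<omega>. f (X \<omega>)) T' (\<lambda>\<omega>. g (Y \<omega>))"
proof -
  note f[measurable] g[measurable]
  have X[measurable]: "X \<in> measurable M S" and Y[measurable]: "Y \<in> measurable M T"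
    and eq: "distr M S X \<Otimes>\<^sub>M distr M T Y = distr M (S \<Otimes>\<^sub>M T) (\<lambda>x. (X x, Y x))"
    using ind unfolding indep_var_distribution_eq by auto
  interpret X: prob_space "distr M S X" by (rule prob_space_distr) simp
  interpret Y: prob_space "distr M T Y" by (rule prob_space_distr) simp
  interpret Yg: prob_space "distr (distr M T Y) T' g" by (rule Y.prob_space_distr) simp
  have "distr M S' (\<lambda>\<omega>. f (X \<omega>)) \<Otimes>\<^sub>M distr M T' (\<lambda>\<omega>. g (Y \<omega>))
      = distr (distr M S X) S' f \<Otimes>\<^sub>M distr (distr M T Y) T' g"
    by (simp add: distr_distr o_def)
  also have "\<dots> = distr (distr M S X \<Otimes>\<^sub>M distr M T Y) (S' \<Otimes>\<^sub>M T') (\<lambda>(x, y). (f x, g y))"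
    by (rule pair_measure_distr) (auto intro: Yg.sigma_finite_measure_axioms)
  also have "\<dots> = distr M (S' \<Otimes>\<^sub>M T') (\<lambda>\<omega>. (f (X \<omega>), g (Y \<omega>)))"
    unfolding eq by (simp add: distr_distr o_def)
  finally show ?thesis
    unfolding indep_rv_def by auto
qed

text \<open>
  Fubini for the joint law: the second argument may be resampled on a separate copy of the probability
  space. This plays the role of conditioning on \<open>X\<close>.
\<close>

lemma (in prob_space) nn_integral_indep_copy:
  assumes ind: "indep_rv S X T Y" and f: "f \<in> borel_measurable (S \<Otimes>\<^sub>M T)"
  shows "(\<integral>\<^sup>+\<omega>. f (X \<omega>, Y \<omega>) \<partial>M) = (\<integral>\<^sup>+\<omega>. \<integral>\<^sup>+\<omega>'. f (X \<omega>, Y \<omega>') \<partial>M \<partial>M)"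
proof -
  have X[measurable]: "X \<in> measurable M S" and Y[measurable]: "Y \<in> measurable M T"
    and eq: "distr M S X \<Otimes>\<^sub>M distr M T Y = distr M (S \<Otimes>\<^sub>M T) (\<lambda>x. (X x, Y x))"
    using ind unfolding indep_rv_def by auto
  note f[measurable]
  interpret Y: prob_space "distr M T Y" by (rule prob_space_distr) simp
  have "(\<integral>\<^sup>+\<omega>. f (X \<omega>, Y \<omega>) \<partial>M) = (\<integral>\<^sup>+z. f z \<partial>(distr M S X \<Otimes>\<^sub>M distr M T Y))"
    unfolding eq by (simp add: nn_integral_distr)
  also have "\<dots> = (\<integral>\<^sup>+x. \<integral>\<^sup>+y. f (x, y) \<partial>distr M T Y \<partial>distr M S X)"
    by (rule Y.nn_integral_fst[symmetric]) simp
  also have "\<dots> = (\<integral>\<^sup>+\<omega>. \<integral>\<^sup>+y. f (X \<omega>, y) \<partial>distr M T Y \<partial>M)"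
    by (subst nn_integral_distr) (auto intro!: Y.borel_measurable_nn_integral)
  also have "\<dots> = (\<integral>\<^sup>+\<omega>. \<integral>\<^sup>+\<omega>'. f (X \<omega>, Y \<omega>') \<partial>M \<partial>M)"
    using measurable_space[OF X] by (intro nn_integral_cong nn_integral_distr) (auto)
  finally show ?thesis .
qed

lemma (in prob_space) second_moment_bias_variance:
  fixes Z :: "'a \<Rightarrow> 'b::euclidean_space"
  assumes Z: "integrable M Z" and var: "integrable M (\<lambda>\<omega>. (norm (Z \<omega> - expectation Z))\<^sup>2)"
  shows "integrable M (\<lambda>\<omega>. (norm (u - c *\<^sub>R Z \<omega>))\<^sup>2)"
    and "expectation (\<lambda>\<omega>. (norm (u - c *\<^sub>R Z \<omega>))\<^sup>2)
      = (norm (u - c *\<^sub>R expectation Z))\<^sup>2 + c\<^sup>2 * expectation (\<lambda>\<omega>. (norm (Z \<omega> - expectation Z))\<^sup>2)"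
proof -
  let ?m = "expectation Z"
  have eq: "(\<lambda>\<omega>. (norm (u - c *\<^sub>R Z \<omega>))\<^sup>2) =
      (\<lambda>\<omega>. (norm (u - c *\<^sub>R ?m))\<^sup>2 - 2 * c * ((Z \<omega> - ?m) \<bullet> (u - c *\<^sub>R ?m)) + c\<^sup>2 * (norm (Z \<omega> - ?m))\<^sup>2)"
    unfolding power2_norm_eq_inner
    by (rule ext)
      (simp add: inner_diff_left inner_diff_right inner_commute power2_eq_square algebra_simps)
  show "integrable M (\<lambda>\<omega>. (norm (u - c *\<^sub>R Z \<omega>))\<^sup>2)"
    unfolding eq using Z var by (intro Bochner_Integration.integrable_add Bochner_Integration.integrable_diff integrable_mult_right integrable_inner_left) auto
  have "expectation (\<lambda>\<omega>. (Z \<omega> - ?m) \<bullet> (u - c *\<^sub>R ?m)) = 0"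
    using Z by (subst integral_inner_left) (auto simp: prob_space)
  then show "expectation (\<lambda>\<omega>. (norm (u - c *\<^sub>R Z \<omega>))\<^sup>2)
      = (norm (u - c *\<^sub>R ?m))\<^sup>2 + c\<^sup>2 * expectation (\<lambda>\<omega>. (norm (Z \<omega> - ?m))\<^sup>2)"
    unfolding eq using Z var
    by (subst Bochner_Integration.integral_add Bochner_Integration.integral_diff; 
       (intro Bochner_Integration.integrable_diff integrable_mult_right integrable_inner_left)?; simp add: prob_space)+
qed

text \<open>
  The inner product is a finite sum of products of coordinates, to each of which the product rule for
  independent real variables applies.
\<close>

lemma (in prob_space) indep_centred_orthogonal:
  fixes V W :: "'a \<Rightarrow> 'b::euclidean_space"
  assumes ind: "indep_var borel V borel W"
    and int: "integrable M V" "integrable M W" and mean: "expectation V = 0"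
  shows "integrable M (\<lambda>\<omega>. V \<omega> \<bullet> W \<omega>)" and "expectation (\<lambda>\<omega>. V \<omega> \<bullet> W \<omega>) = 0"
proof -
  have ind': "indep_var borel (\<lambda>\<omega>. V \<omega> \<bullet> e) borel (\<lambda>\<omega>. W \<omega> \<bullet> e)" for e
    using indep_var_compose[OF ind, of "\<lambda>x. x \<bullet> e" borel "\<lambda>x. x \<bullet> e" borel] by (simp add: o_def)
  have i: "integrable M (\<lambda>\<omega>. V \<omega> \<bullet> e)" "integrable M (\<lambda>\<omega>. W \<omega> \<bullet> e)" for e
    using int by (auto intro!: integrable_inner_left)
  have eq: "(\<lambda>\<omega>. V \<omega> \<bullet> W \<omega>) = (\<lambda>\<omega>. \<Sum>e\<in>Basis. (V \<omega> \<bullet> e) * (W \<omega> \<bullet> e))"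
    by (rule ext) (rule euclidean_inner)
  have prod: "integrable M (\<lambda>\<omega>. (V \<omega> \<bullet> e) * (W \<omega> \<bullet> e))" for e
    by (rule indep_var_integrable[OF ind' i])
  have zero: "expectation (\<lambda>\<omega>. (V \<omega> \<bullet> e) * (W \<omega> \<bullet> e)) = 0" for e
    using indep_var_lebesgue_integral[OF ind'[of e] i] int mean by simp
  show "integrable M (\<lambda>\<omega>. V \<omega> \<bullet> W \<omega>)"
    unfolding eq using prod by auto
  show "expectation (\<lambda>\<omega>. V \<omega> \<bullet> W \<omega>) = 0"
    unfolding eq using prod zero by simp
qed

text \<open>
  Expanding the square, the off-diagonal inner products vanish by orthogonality.
\<close>

lemma (in prob_space) second_moment_indep_sum:
  fixes V :: "'i \<Rightarrow> 'a \<Rightarrow> 'b::euclidean_space"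
  assumes fin: "finite I" and ind: "indep_vars (\<lambda>_. borel) V I"
    and int: "\<And>i. i \<in> I \<Longrightarrow> integrable M (V i)" and mean: "\<And>i. i \<in> I \<Longrightarrow> expectation (V i) = 0"
    and sq: "\<And>i. i \<in> I \<Longrightarrow> integrable M (\<lambda>\<omega>. (norm (V i \<omega>))\<^sup>2)"
  shows "integrable M (\<lambda>\<omega>. (norm (\<Sum>i\<in>I. V i \<omega>))\<^sup>2)"
    and "expectation (\<lambda>\<omega>. (norm (\<Sum>i\<in>I. V i \<omega>))\<^sup>2) = (\<Sum>i\<in>I. expectation (\<lambda>\<omega>. (norm (V i \<omega>))\<^sup>2))"
proof -
  have eq: "(norm (\<Sum>i\<in>I. V i \<omega>))\<^sup>2 = (\<Sum>i\<in>I. \<Sum>j\<in>I. V i \<omega> \<bullet> V j \<omega>)" for \<omega>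
    by (simp add: power2_norm_eq_inner inner_sum_left inner_sum_right)
      (subst sum.swap, rule refl)
  have pair: "integrable M (\<lambda>\<omega>. V i \<omega> \<bullet> V j \<omega>) \<and>
      expectation (\<lambda>\<omega>. V i \<omega> \<bullet> V j \<omega>) = (if i = j then expectation (\<lambda>\<omega>. (norm (V i \<omega>))\<^sup>2) else 0)"
    if "i \<in> I" "j \<in> I" for i j
  proof (cases "i = j")
    case True
    then show ?thesis using sq[OF that(1)] by (simp add: power2_norm_eq_inner)
  next
    case False
    have ij: "indep_var borel (V i) borel (V j)"
      using indep_var_compose[OF indep_var_restrict[OF ind, of "{i}" "{j}"],
          of "\<lambda>f. f i" borel "\<lambda>f. f j" borel] False that
      by (simp add: o_def)
    show ?thesis
      using indep_centred_orthogonal[OF ij int[OF that(1)] int[OF that(2)] mean[OF that(1)]] False by simp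
  qed
  show "integrable M (\<lambda>\<omega>. (norm (\<Sum>i\<in>I. V i \<omega>))\<^sup>2)"
    unfolding eq using pair by auto
  show "expectation (\<lambda>\<omega>. (norm (\<Sum>i\<in>I. V i \<omega>))\<^sup>2) = (\<Sum>i\<in>I. expectation (\<lambda>\<omega>. (norm (V i \<omega>))\<^sup>2))"
    unfolding eq using pair fin by (simp add: sum.delta)
qed

section \<open>One step in expectation\<close>

text \<open>
  Batches enter only as the random arguments \<open>Z1\<close> and \<open>Z2\<close> of a measurable estimator \<open>H\<close>, so that the batch
  size is hidden in \<open>\<delta>\<close> and \<open>v\<close>. The moment hypotheses are at deterministic points \<open>x\<close>; the resampling
  lemma extends them to the random points at which the estimators are evaluated.
\<close>

lemma (in prob_space) extragradient_expected_step:
  fixes F :: "'b::euclidean_space \<Rightarrow> 'b" and H :: "'n \<Rightarrow> 'b \<Rightarrow> 'b"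
  assumes H: "(\<lambda>(z, x). H z x) \<in> borel_measurable (N \<Otimes>\<^sub>M borel)"
    and ind1: "indep_rv borel X N Z1"
    and ind2: "indep_rv (borel \<Otimes>\<^sub>M N) (\<lambda>\<omega>. (X \<omega>, Z1 \<omega>)) N Z2"
    and var1: "\<And>x. integrable M (\<lambda>\<omega>. (norm (H (Z1 \<omega>) x - F x))\<^sup>2)"
      "\<And>x. expectation (\<lambda>\<omega>. (norm (H (Z1 \<omega>) x - F x))\<^sup>2) \<le> \<delta> * (norm (x - p))\<^sup>2 + v"
    and mean2: "\<And>x. integrable M (\<lambda>\<omega>. H (Z2 \<omega>) x)" "\<And>x. expectation (\<lambda>\<omega>. H (Z2 \<omega>) x) = F x"
    and var2: "\<And>x. integrable M (\<lambda>\<omega>. (norm (H (Z2 \<omega>) x - F x))\<^sup>2)"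
      "\<And>x. expectation (\<lambda>\<omega>. (norm (H (Z2 \<omega>) x - F x))\<^sup>2) \<le> \<delta> * (norm (x - p))\<^sup>2 + v"
    and lip: "L-lipschitz_on UNIV F" and mon: "\<And>x. F x \<bullet> (x - p) \<ge> \<mu> * (norm (x - p))\<^sup>2"
    and pos: "\<gamma> > 0" "\<mu> > 0" "0 < \<alpha>" "\<alpha> \<le> 1 / 4" "\<delta> \<ge> 0" "v \<ge> 0"
    and step_lip: "6 * L\<^sup>2 * \<gamma>\<^sup>2 \<le> 1" and step_mon: "4 * \<gamma> * \<mu> \<le> 1" and step_noise: "18 * \<delta> * \<gamma> \<le> \<mu>"
  shows "(\<integral>\<^sup>+\<omega>. ennreal ((norm (X \<omega> - (\<alpha> * \<gamma>) *\<^sub>R H (Z2 \<omega>) (X \<omega> - \<gamma> *\<^sub>R H (Z1 \<omega>) (X \<omega>)) - p))\<^sup>2) \<partial>M)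
    \<le> ennreal (1 - \<alpha> * \<gamma> * \<mu> / 8) * (\<integral>\<^sup>+\<omega>. ennreal ((norm (X \<omega> - p))\<^sup>2) \<partial>M)
      + ennreal (\<alpha> * \<gamma>\<^sup>2 * (2 + \<alpha>) * v)"
proof -
  have X[measurable]: "X \<in> borel_measurable M" and Z1[measurable]: "Z1 \<in> measurable M N"
    using ind1 unfolding indep_rv_def by auto
  have Z2[measurable]: "Z2 \<in> measurable M N"
    using ind2 unfolding indep_rv_def by auto
  have F[measurable]: "F \<in> borel_measurable borel"
    using lip by (intro borel_measurable_continuous_onI lipschitz_on_continuous_on)
  have H'[measurable]: "(\<lambda>w. H (f w) (g w)) \<in> borel_measurable A"
    if "f \<in> measurable A N" "g \<in> borel_measurable A" for f g and A :: "'c measure"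
    using measurable_compose[OF measurable_Pair[OF that] H] by simp
  have L: "L \<ge> 0"
    using lip by (rule lipschitz_on_nonneg)
  let ?a = "\<alpha> * \<gamma>"
  let ?c = "1 - 143 / 144 * (\<alpha> * \<gamma> * \<mu>)"
  let ?\<rho> = "1 - \<alpha> * \<gamma> * \<mu> / 8"
  have "\<alpha> * (\<gamma> * \<mu>) \<le> 1 / 4 * (1 / 4)"
    using pos step_mon by (intro mult_mono) auto
  then have small: "\<alpha> * \<gamma> * \<mu> \<le> 1 / 16"
    by (simp add: mult.assoc)
  have second: "(\<integral>\<^sup>+\<omega>'. ennreal ((norm (x - ?a *\<^sub>R H (Z2 \<omega>') (x - \<gamma> *\<^sub>R H z x) - p))\<^sup>2) \<partial>M)
      \<le> ennreal (?c * (norm (x - p))\<^sup>2 + 2 * \<alpha> * \<gamma>\<^sup>2 * (norm (H z x - F x))\<^sup>2 + ?a\<^sup>2 * v)" for x z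
  proof -
    let ?y = "x - \<gamma> *\<^sub>R H z x"
    have mean: "expectation (\<lambda>\<omega>. H (Z2 \<omega>) ?y) = F ?y"
      by (rule mean2)
    note bv = second_moment_bias_variance[OF mean2(1)[of ?y], unfolded mean, OF var2(1), of "x - p" ?a]
    have swap: "x - ?a *\<^sub>R w - p = x - p - ?a *\<^sub>R w" for w
      by simp
    have "(\<integral>\<^sup>+\<omega>'. ennreal ((norm (x - ?a *\<^sub>R H (Z2 \<omega>') ?y - p))\<^sup>2) \<partial>M)
        = ennreal (expectation (\<lambda>\<omega>'. (norm (x - p - ?a *\<^sub>R H (Z2 \<omega>') ?y))\<^sup>2))"
      unfolding swap using bv(1) by (intro nn_integral_eq_integral) auto
    also have "\<dots> \<le> ennreal ((norm (x - p - ?a *\<^sub>R F ?y))\<^sup>2 + ?a\<^sup>2 * (\<delta> * (norm (?y - p))\<^sup>2 + v))"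
      unfolding bv(2) using var2(2)[of ?y] by (intro ennreal_leI add_left_mono mult_left_mono) auto
    also have "\<dots> \<le> ennreal (?c * (norm (x - p))\<^sup>2 + 2 * \<alpha> * \<gamma>\<^sup>2 * (norm (H z x - F x))\<^sup>2 + ?a\<^sup>2 * v)"
      using lipschitz_onD[OF lip, of x ?y]
      by (intro ennreal_leI extragradient_step_ineq[OF _ _ pos(1-5) L step_lip step_mon step_noise] mon)
        (auto simp: dist_norm)
    finally show ?thesis .
  qed
  have first: "(\<integral>\<^sup>+\<omega>'. ennreal (?c * (norm (x - p))\<^sup>2 + 2 * \<alpha> * \<gamma>\<^sup>2 * (norm (H (Z1 \<omega>') x - F x))\<^sup>2 + ?a\<^sup>2 * v) \<partial>M)
      \<le> ennreal (?\<rho> * (norm (x - p))\<^sup>2 + \<alpha> * \<gamma>\<^sup>2 * (2 + \<alpha>) * v)" (is "?lhs \<le> _") for x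
  proof -
    let ?r = "(norm (x - p))\<^sup>2"
    let ?e = "expectation (\<lambda>\<omega>'. (norm (H (Z1 \<omega>') x - F x))\<^sup>2)"
    have "?lhs = ennreal (expectation (\<lambda>\<omega>'. ?c * ?r + 2 * \<alpha> * \<gamma>\<^sup>2 * (norm (H (Z1 \<omega>') x - F x))\<^sup>2 + ?a\<^sup>2 * v))"
      using var1(1) small pos by (intro nn_integral_eq_integral) auto
    also have "\<dots> = ennreal (?c * ?r + 2 * \<alpha> * \<gamma>\<^sup>2 * ?e + ?a\<^sup>2 * v)"
      using var1(1)[of x] by (simp add: prob_space)
    also have "\<dots> \<le> ennreal (?c * ?r + 2 * \<alpha> * \<gamma>\<^sup>2 * (\<delta> * ?r + v) + ?a\<^sup>2 * v)"
      using var1(2)[of x] pos by (intro ennreal_leI add_right_mono add_left_mono mult_left_mono) auto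
    also have "\<dots> \<le> ennreal (?\<rho> * ?r + \<alpha> * \<gamma>\<^sup>2 * (2 + \<alpha>) * v)"
    proof (rule ennreal_leI)
      \<comment> \<open>The \<open>\<delta>\<close>-part of the first-stage noise is at most \<open>\<alpha> \<gamma> \<mu> / 9\<close> times \<open>?r\<close>, and \<open>143 / 144 - 1 / 9 \<ge> 1 / 8\<close>.\<close>
      have "?a * ?r * (2 * (18 * \<delta> * \<gamma>)) \<le> ?a * ?r * (2 * \<mu>)"
        using step_noise pos by (intro mult_left_mono) auto
      moreover have "?a * ?r * \<mu> \<ge> 0"
        using pos by simp
      ultimately show "?c * ?r + 2 * \<alpha> * \<gamma>\<^sup>2 * (\<delta> * ?r + v) + ?a\<^sup>2 * v
          \<le> ?\<rho> * ?r + \<alpha> * \<gamma>\<^sup>2 * (2 + \<alpha>) * v"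
        by (simp add: power2_eq_square algebra_simps)
    qed
    finally show ?thesis .
  qed
  \<comment> \<open>Two conditionings: replace \<open>Z2\<close> by an independent copy and average it out, then \<open>Z1\<close>.\<close>
  let ?Q = "\<lambda>(x, z). ennreal (?c * (norm (x - p))\<^sup>2 + 2 * \<alpha> * \<gamma>\<^sup>2 * (norm (H z x - F x))\<^sup>2 + ?a\<^sup>2 * v)"
  let ?P = "\<lambda>((x, z), z'). ennreal ((norm (x - ?a *\<^sub>R H z' (x - \<gamma> *\<^sub>R H z x) - p))\<^sup>2)"
  have Pm: "?P \<in> borel_measurable ((borel \<Otimes>\<^sub>M N) \<Otimes>\<^sub>M N)"
    unfolding case_prod_beta
    by (intro measurable_compose[OF _ measurable_ennreal] borel_measurable_power borel_measurable_norm
        borel_measurable_diff borel_measurable_scaleR H') measurable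
  have Qm: "?Q \<in> borel_measurable (borel \<Otimes>\<^sub>M N)"
    unfolding case_prod_beta
    by (intro measurable_compose[OF _ measurable_ennreal] borel_measurable_power borel_measurable_norm
        borel_measurable_diff borel_measurable_add borel_measurable_times borel_measurable_scaleR H'
        measurable_compose[OF _ F]) measurable
  have "(\<integral>\<^sup>+\<omega>. ennreal ((norm (X \<omega> - ?a *\<^sub>R H (Z2 \<omega>) (X \<omega> - \<gamma> *\<^sub>R H (Z1 \<omega>) (X \<omega>)) - p))\<^sup>2) \<partial>M)
      = (\<integral>\<^sup>+\<omega>. \<integral>\<^sup>+\<omega>'. ennreal ((norm (X \<omega> - ?a *\<^sub>R H (Z2 \<omega>') (X \<omega> - \<gamma> *\<^sub>R H (Z1 \<omega>) (X \<omega>)) - p))\<^sup>2) \<partial>M \<partial>M)"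
    using nn_integral_indep_copy[OF ind2 Pm] by simp
  also have "\<dots> \<le> (\<integral>\<^sup>+\<omega>. ?Q (X \<omega>, Z1 \<omega>) \<partial>M)"
    by (intro nn_integral_mono) (simp only: prod.case second)
  also have "\<dots> = (\<integral>\<^sup>+\<omega>. \<integral>\<^sup>+\<omega>'. ?Q (X \<omega>, Z1 \<omega>') \<partial>M \<partial>M)"
    by (rule nn_integral_indep_copy[OF ind1 Qm])
  also have "\<dots> \<le> (\<integral>\<^sup>+\<omega>. ennreal (?\<rho> * (norm (X \<omega> - p))\<^sup>2 + \<alpha> * \<gamma>\<^sup>2 * (2 + \<alpha>) * v) \<partial>M)"
    by (intro nn_integral_mono) (simp only: prod.case first)
  also have "\<dots> = (\<integral>\<^sup>+\<omega>. ennreal ?\<rho> * ennreal ((norm (X \<omega> - p))\<^sup>2) + ennreal (\<alpha> * \<gamma>\<^sup>2 * (2 + \<alpha>) * v) \<partial>M)"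
    using small pos by (intro nn_integral_cong) (simp add: ennreal_plus ennreal_mult'')
  also have "\<dots> = ennreal ?\<rho> * (\<integral>\<^sup>+\<omega>. ennreal ((norm (X \<omega> - p))\<^sup>2) \<partial>M) + ennreal (\<alpha> * \<gamma>\<^sup>2 * (2 + \<alpha>) * v)"
    by (simp add: nn_integral_add nn_integral_cmult emeasure_space_1)
  finally show ?thesis .
qed

section \<open>Mini-batches and iterates\<close>

text \<open>
  The centred summands are independent, so their second moments add up and the average gains a factor
  \<open>1 / b\<close>.
\<close>

lemma (in prob_space) minibatch_moments:
  fixes G :: "'s \<Rightarrow> real ^ 'd \<Rightarrow> real ^ 'd"
  assumes est: "stochastic_estimator D G F xs \<delta> \<sigma>" and b: "b \<ge> 1"
    and ind: "indep_vars (\<lambda>_. D) \<zeta> {1..b}" and law: "\<And>i. i \<in> {1..b} \<Longrightarrow> distr M D (\<zeta> i) = D"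
  shows "integrable M (\<lambda>\<omega>. minibatch G b (\<lambda>i. \<zeta> i \<omega>) x)"
    and "expectation (\<lambda>\<omega>. minibatch G b (\<lambda>i. \<zeta> i \<omega>) x) = F x"
    and "integrable M (\<lambda>\<omega>. (norm (minibatch G b (\<lambda>i. \<zeta> i \<omega>) x - F x))\<^sup>2)"
    and "expectation (\<lambda>\<omega>. (norm (minibatch G b (\<lambda>i. \<zeta> i \<omega>) x - F x))\<^sup>2)
      \<le> \<delta> / real b * (norm (x - xs))\<^sup>2 + \<sigma>\<^sup>2 / real b"
proof -
  have Gm: "(\<lambda>(s, x). G s x) \<in> borel_measurable (D \<Otimes>\<^sub>M borel)"
    and Gi: "integrable D (\<lambda>s. G s x)" "(\<integral>s. G s x \<partial>D) = F x"
    and Gv: "integrable D (\<lambda>s. (norm (G s x - F x))\<^sup>2)"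
      "(\<integral>s. (norm (G s x - F x))\<^sup>2 \<partial>D) \<le> \<delta> * (norm (x - xs))\<^sup>2 + \<sigma>\<^sup>2"
    using est unfolding stochastic_estimator_def by auto
  have Gx[measurable]: "(\<lambda>s. G s x) \<in> borel_measurable D"
    using Gi(1) by auto
  have \<zeta>: "\<zeta> i \<in> measurable M D" if "i \<in> {1..b}" for i
    using ind that unfolding indep_vars_def by auto
  have pull: "integrable M (\<lambda>\<omega>. g (\<zeta> i \<omega>)) \<and> expectation (\<lambda>\<omega>. g (\<zeta> i \<omega>)) = (\<integral>s. g s \<partial>D)"
    if i: "i \<in> {1..b}" and g: "integrable D g" for i and g :: "'s \<Rightarrow> 'c::{banach, second_countable_topology}"
    using integrable_distr_eq[OF \<zeta>[OF i], of g] integral_distr[OF \<zeta>[OF i], of g] g law[OF i] by auto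
  note G1 = pull[OF _ Gi(1)]
  show int: "integrable M (\<lambda>\<omega>. minibatch G b (\<lambda>i. \<zeta> i \<omega>) x)"
    unfolding minibatch_def
    using G1 by (intro integrable_scaleR_right Bochner_Integration.integrable_sum) blast
  show "expectation (\<lambda>\<omega>. minibatch G b (\<lambda>i. \<zeta> i \<omega>) x) = F x"
    unfolding minibatch_def using G1 Gi(2) b by (simp add: sum_constant_scaleR del: sum_constant)
  define V where "V i \<omega> = G (\<zeta> i \<omega>) x - F x" for i \<omega>
  have Vind: "indep_vars (\<lambda>_. borel) V {1..b}"
    unfolding V_def by (rule indep_vars_compose2[OF ind, of "\<lambda>_ s. G s x - F x"]) auto
  have Vint: "integrable M (V i)" "expectation (V i) = 0" if "i \<in> {1..b}" for i
    using G1[OF that] Gi(2) by (simp_all add: V_def[abs_def] prob_space)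
  have Vsq: "integrable M (\<lambda>\<omega>. (norm (V i \<omega>))\<^sup>2)"
      "expectation (\<lambda>\<omega>. (norm (V i \<omega>))\<^sup>2) \<le> \<delta> * (norm (x - xs))\<^sup>2 + \<sigma>\<^sup>2" if "i \<in> {1..b}" for i
    using pull[OF that Gv(1)] Gv(2) by (simp_all add: V_def)
  note sum = second_moment_indep_sum[OF _ Vind Vint Vsq(1), simplified]
  have "minibatch G b (\<lambda>i. \<zeta> i \<omega>) x - F x = (1 / real b) *\<^sub>R (\<Sum>i = 1..b. V i \<omega>)" for \<omega>
    using b by (simp add: minibatch_def V_def sum_subtractf sum_constant_scaleR scaleR_diff_right del: sum_constant)
  then have eq: "(norm (minibatch G b (\<lambda>i. \<zeta> i \<omega>) x - F x))\<^sup>2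
      = (1 / (real b)\<^sup>2) * (norm (\<Sum>i = 1..b. V i \<omega>))\<^sup>2" for \<omega>
    by (simp add: power_mult_distrib power_divide)
  show "integrable M (\<lambda>\<omega>. (norm (minibatch G b (\<lambda>i. \<zeta> i \<omega>) x - F x))\<^sup>2)"
    unfolding eq using sum(1) by (intro integrable_mult_right) auto
  have "expectation (\<lambda>\<omega>. (norm (minibatch G b (\<lambda>i. \<zeta> i \<omega>) x - F x))\<^sup>2)
      = (1 / (real b)\<^sup>2) * (\<Sum>i = 1..b. expectation (\<lambda>\<omega>. (norm (V i \<omega>))\<^sup>2))"
    unfolding eq using sum(2) by simp
  also have "\<dots> \<le> (1 / (real b)\<^sup>2) * (\<Sum>i = 1..b. \<delta> * (norm (x - xs))\<^sup>2 + \<sigma>\<^sup>2)"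
    using Vsq(2) by (intro mult_left_mono sum_mono) auto
  also have "\<dots> = \<delta> / real b * (norm (x - xs))\<^sup>2 + \<sigma>\<^sup>2 / real b"
    using b by (simp add: power2_eq_square field_simps)
  finally show "expectation (\<lambda>\<omega>. (norm (minibatch G b (\<lambda>i. \<zeta> i \<omega>) x - F x))\<^sup>2)
      \<le> \<delta> / real b * (norm (x - xs))\<^sup>2 + \<sigma>\<^sup>2 / real b" .
qed

lemma minibatch_cong:
  "(\<And>i. i \<in> {1..b} \<Longrightarrow> z i = z' i) \<Longrightarrow> minibatch G b z = minibatch G b z'"
  unfolding minibatch_def by (auto intro!: ext sum.cong arg_cong[where f = "scaleR _"])

definition samples_before :: "nat \<Rightarrow> nat \<Rightarrow> (nat \<times> nat \<times> nat) set" where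
  "samples_before b k = {1, 2} \<times> {..<k} \<times> {1..b}"

lemma iseg_cong:
  "(\<And>j l i. (j, l, i) \<in> samples_before b k \<Longrightarrow> z j l i = z' j l i) \<Longrightarrow>
    iseg G b \<gamma>1 \<gamma>2 x0 z k = iseg G b \<gamma>1 \<gamma>2 x0 z' k"
proof (induction k)
  case (Suc k)
  have IH: "iseg G b \<gamma>1 \<gamma>2 x0 z k = iseg G b \<gamma>1 \<gamma>2 x0 z' k"
    using Suc.prems by (intro Suc.IH) (auto simp: samples_before_def)
  have "minibatch G b (z j k) = minibatch G b (z' j k)" if "j \<in> {1, 2}" for j
    using Suc.prems that by (intro minibatch_cong) (auto simp: samples_before_def)
  with IH show ?case by simp
qed simp

lemma minibatch_measurable:
  assumes "(\<lambda>(s, x). G s x) \<in> borel_measurable (D \<Otimes>\<^sub>M borel)"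
    and "\<And>i. i \<in> {1..b} \<Longrightarrow> (\<lambda>w. z w i) \<in> measurable A D" and "X \<in> borel_measurable A"
  shows "(\<lambda>w. minibatch G b (z w) (X w)) \<in> borel_measurable A"
proof -
  have "(\<lambda>w. G (z w i) (X w)) \<in> borel_measurable A" if "i \<in> {1..b}" for i
    using measurable_compose[OF measurable_Pair[OF assms(2)[OF that] assms(3)] assms(1)] by simp
  then show ?thesis
    unfolding minibatch_def by auto
qed

text \<open>
  The index set \<open>I\<close> is free because the iterate has to be read both as a function of the samples before
  step \<open>k\<close> and as a function of these together with the first batch of step \<open>k\<close>.
\<close>

lemma iseg_measurable:
  assumes G: "(\<lambda>(s, x). G s x) \<in> borel_measurable (D \<Otimes>\<^sub>M borel)"
    and "samples_before b k \<subseteq> I"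
  shows "(\<lambda>\<zeta>. iseg G b \<gamma>1 \<gamma>2 x0 (\<lambda>j l i. \<zeta> (j, l, i)) k) \<in> borel_measurable (Pi\<^sub>M I (\<lambda>_. D))"
  using assms(2)
proof (induction k)
  case (Suc k)
  have X: "(\<lambda>\<zeta>. iseg G b \<gamma>1 \<gamma>2 x0 (\<lambda>j l i. \<zeta> (j, l, i)) k) \<in> borel_measurable (Pi\<^sub>M I (\<lambda>_. D))"
    using Suc.prems by (intro Suc.IH) (auto simp: samples_before_def)
  have z: "(\<lambda>\<zeta>. \<zeta> (j, k, i)) \<in> measurable (Pi\<^sub>M I (\<lambda>_. D)) D" if "j \<in> {1, 2}" "i \<in> {1..b}" for j i
    using Suc.prems that by (intro measurable_component_singleton) (auto simp: samples_before_def)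
  show ?case
    unfolding iseg.simps Let_def
    by (intro borel_measurable_diff borel_measurable_scaleR borel_measurable_const
        minibatch_measurable[OF G] X z) auto
qed simp

text \<open>
  The sample blocks read by \<open>x\<^sup>k\<close>, by the first and by the second batch of step \<open>k\<close> are disjoint.
\<close>

lemma (in prob_space) iseg_indep_batches:
  fixes G :: "'s \<Rightarrow> real ^ 'd \<Rightarrow> real ^ 'd" and x0 :: "real ^ 'd" and \<gamma>1 \<gamma>2 :: real
  assumes G: "(\<lambda>(s, x). G s x) \<in> borel_measurable (D \<Otimes>\<^sub>M borel)"
    and ind: "indep_vars (\<lambda>_. D) (\<lambda>(j, k, i). \<xi> j k i) ({1, 2} \<times> UNIV \<times> {1..b})"
  defines "X \<equiv> \<lambda>k \<omega>. iseg G b \<gamma>1 \<gamma>2 x0 (\<lambda>j k i. \<xi> j k i \<omega>) k"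
    and "N \<equiv> Pi\<^sub>M {1..b} (\<lambda>_. D)"
    and "Z \<equiv> \<lambda>j k \<omega>. \<lambda>i\<in>{1..b}. \<xi> j k i \<omega>"
  shows "indep_rv borel (X k) N (Z 1 k)"
    and "indep_rv (borel \<Otimes>\<^sub>M N) (\<lambda>\<omega>. (X k \<omega>, Z 1 k \<omega>)) N (Z 2 k)"
proof -
  \<comment> \<open>Restrictions of an independent family to disjoint index blocks are independent; the iterate and
    the batches are measurable functions of such restrictions.\<close>
  define U where "U I \<omega> = (\<lambda>t\<in>I. (case t of (j, k, i) \<Rightarrow> \<xi> j k i) \<omega>)" for I \<omega>
  define B where "B j k = {j} \<times> {k} \<times> {1..b}" for j k :: nat
  have U: "U I \<omega> (j, k, i) = \<xi> j k i \<omega>" if "(j, k, i) \<in> I" for I \<omega> j k i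
    using that by (simp add: U_def)
  have X_U: "X k \<omega> = iseg G b \<gamma>1 \<gamma>2 x0 (\<lambda>j l i. U I \<omega> (j, l, i)) k"
    if "samples_before b k \<subseteq> I" for k \<omega> I
    unfolding X_def using that by (intro iseg_cong) (auto simp: U)
  have Z_U: "Z j k \<omega> = (\<lambda>i\<in>{1..b}. U I \<omega> (j, k, i))" if "B j k \<subseteq> I" for j k \<omega> I
    unfolding Z_def using that by (intro restrict_ext U[symmetric]) (auto simp: B_def)
  have batch: "(\<lambda>\<zeta>. \<lambda>i\<in>{1..b}. \<zeta> (j, k, i)) \<in> measurable (Pi\<^sub>M I (\<lambda>_. D)) N"
    if "B j k \<subseteq> I" for j k I
    unfolding N_def using that
    by (intro measurable_restrict measurable_component_singleton) (auto simp: B_def)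
  have indU: "indep_var (Pi\<^sub>M I (\<lambda>_. D)) (U I) (Pi\<^sub>M J (\<lambda>_. D)) (U J)"
    if "I \<inter> J = {}" "I \<subseteq> {1, 2} \<times> UNIV \<times> {1..b}" "J \<subseteq> {1, 2} \<times> UNIV \<times> {1..b}" for I J
    unfolding U_def[abs_def] by (rule indep_var_restrict[OF ind that])
  show "indep_rv borel (X k) N (Z 1 k)"
  proof -
    have "indep_rv borel (\<lambda>\<omega>. iseg G b \<gamma>1 \<gamma>2 x0 (\<lambda>j l i. U (samples_before b k) \<omega> (j, l, i)) k)
        N (\<lambda>\<omega>. \<lambda>i\<in>{1..b}. U (B 1 k) \<omega> (1, k, i))"
      by (rule indep_rv_compose[OF indU iseg_measurable[OF G order_refl] batch[OF order_refl]])
        (auto simp: samples_before_def B_def)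
    then show ?thesis
      by (simp add: X_U[OF order_refl, abs_def] Z_U[OF order_refl, abs_def])
  qed
  show "indep_rv (borel \<Otimes>\<^sub>M N) (\<lambda>\<omega>. (X k \<omega>, Z 1 k \<omega>)) N (Z 2 k)"
  proof -
    let ?I = "samples_before b k \<union> B 1 k"
    have "indep_rv (borel \<Otimes>\<^sub>M N)
        (\<lambda>\<omega>. (\<lambda>\<zeta>. (iseg G b \<gamma>1 \<gamma>2 x0 (\<lambda>j l i. \<zeta> (j, l, i)) k, \<lambda>i\<in>{1..b}. \<zeta> (1, k, i))) (U ?I \<omega>))
        N (\<lambda>\<omega>. \<lambda>i\<in>{1..b}. U (B 2 k) \<omega> (2, k, i))"
      by (rule indep_rv_compose[OF indU measurable_Pair[OF iseg_measurable[OF G] batch] batch[OF order_refl]])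
        (auto simp: samples_before_def B_def)
    moreover have "X k \<omega> = iseg G b \<gamma>1 \<gamma>2 x0 (\<lambda>j l i. U ?I \<omega> (j, l, i)) k"
        "Z 1 k \<omega> = (\<lambda>i\<in>{1..b}. U ?I \<omega> (1, k, i))" for \<omega>
      by (intro X_U Z_U; simp)+
    ultimately show ?thesis
      by (simp add: Z_U[OF order_refl, of 2 k, abs_def])
  qed
qed

text \<open>
  The family is re-indexed by grouping it into the singleton blocks \<open>{(j, k, i)}\<close>, which are disjoint.
\<close>

lemma (in prob_space) indep_vars_batch:
  assumes ind: "indep_vars (\<lambda>_. D) (\<lambda>(j, k, i). \<xi> j k i) ({1, 2} \<times> UNIV \<times> {1..b})"
    and j: "j \<in> {1, 2 :: nat}"
  shows "indep_vars (\<lambda>_. D) (\<xi> j k) {1..b}"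
proof -
  let ?U = "\<lambda>i \<omega>. \<lambda>t\<in>{(j, k, i)}. (case t of (j, k, i) \<Rightarrow> \<xi> j k i) \<omega>"
  have "indep_vars (\<lambda>i. Pi\<^sub>M {(j, k, i)} (\<lambda>_. D)) ?U {1..b}"
    using j by (intro indep_vars_restrict[OF ind]) (auto simp: disjoint_family_on_def)
  then have "indep_vars (\<lambda>_. D) (\<lambda>i \<omega>. ?U i \<omega> (j, k, i)) {1..b}"
    by (rule indep_vars_compose2[where Y = "\<lambda>i \<zeta>. \<zeta> (j, k, i)"]) simp
  then show ?thesis
    by simp
qed

section \<open>Convergence\<close>

text \<open>
  Both summands of the denominator \<open>4 * \<mu> + sqrt \<dots>\<close> are nonnegative, so each of them is at most
  \<open>1 / \<gamma>\<close>.
\<close>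

lemma step_size_bounds:
  fixes \<gamma> \<mu> \<delta> L :: real and b :: nat
  assumes pos: "\<gamma> > 0" "\<mu> > 0" "\<delta> \<ge> 0" "b \<ge> 1"
    and le: "ereal \<gamma> \<le> min (if \<delta> = 0 then \<infinity> else ereal (\<mu> * real b / (18 * \<delta>)))
                           (ereal (1 / (4 * \<mu> + sqrt (6 * (L\<^sup>2 + \<delta> / real b)))))"
  shows "6 * L\<^sup>2 * \<gamma>\<^sup>2 \<le> 1" and "4 * \<gamma> * \<mu> \<le> 1" and "18 * (\<delta> / real b) * \<gamma> \<le> \<mu>"
proof -
  let ?s = "sqrt (6 * (L\<^sup>2 + \<delta> / real b))"
  have s: "?s \<ge> 0" "?s\<^sup>2 = 6 * (L\<^sup>2 + \<delta> / real b)"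
    using pos by simp_all
  have "\<gamma> \<le> 1 / (4 * \<mu> + ?s)"
    using le by simp
  then have "\<gamma> * (4 * \<mu> + ?s) \<le> 1"
    using pos s by (simp add: pos_le_divide_eq add_pos_nonneg)
  then have sum: "4 * \<gamma> * \<mu> + \<gamma> * ?s \<le> 1"
    by (simp add: algebra_simps)
  show step_mon: "4 * \<gamma> * \<mu> \<le> 1"
    using sum pos s(1) mult_nonneg_nonneg[of \<gamma> ?s] by linarith
  have "\<gamma> * ?s \<le> 1"
    using sum pos mult_pos_pos[of \<gamma> \<mu>] by linarith
  then have "(\<gamma> * ?s)\<^sup>2 \<le> 1"
    using pos s(1) by (intro power_le_one) auto
  then have "6 * L\<^sup>2 * \<gamma>\<^sup>2 + 6 * (\<delta> / real b) * \<gamma>\<^sup>2 \<le> 1"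
    unfolding power_mult_distrib s(2) by (simp add: algebra_simps)
  moreover have "6 * (\<delta> / real b) * \<gamma>\<^sup>2 \<ge> 0"
    using pos by simp
  ultimately show step_lip: "6 * L\<^sup>2 * \<gamma>\<^sup>2 \<le> 1"
    by linarith
  show step_noise: "18 * (\<delta> / real b) * \<gamma> \<le> \<mu>"
  proof (cases "\<delta> = 0")
    case False
    then have "\<gamma> \<le> \<mu> * real b / (18 * \<delta>)"
      using le by simp
    then show ?thesis
      using False pos by (simp add: field_simps)
  qed (use pos in simp)
qed

theorem theorem4p1:
  fixes M :: "'w measure" and D :: "'s measure"
    and F :: "real ^ 'd \<Rightarrow> real ^ 'd"
    and G :: "'s \<Rightarrow> real ^ 'd \<Rightarrow> real ^ 'd"
    and \<xi> :: "nat \<Rightarrow> nat \<Rightarrow> nat \<Rightarrow> 'w \<Rightarrow> 's"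
    and x0 xs :: "real ^ 'd"
    and L \<mu> \<delta> \<sigma> \<alpha> \<gamma> \<gamma>1 \<gamma>2 :: real and b K :: nat
  assumes "prob_space M" and "prob_space D"
    and "L-lipschitz_on UNIV F"
    and "\<forall>y. F y = 0 \<longleftrightarrow> y = xs"
    and "\<mu> > 0" and "quasi_strongly_monotone \<mu> F xs"
    and "\<delta> \<ge> 0" and "\<sigma> \<ge> 0"
    and "stochastic_estimator D G F xs \<delta> \<sigma>"
    and "b \<ge> 1" and "iid_samples M D b \<xi>"
    and "\<gamma>1 = \<gamma>" and "\<gamma> > 0"
    and "\<gamma>2 = \<alpha> * \<gamma>1" and "0 < \<alpha>" and "\<alpha> \<le> 1 / 4"
    and "ereal \<gamma> \<le> min (if \<delta> = 0 then \<infinity> else ereal (\<mu> * real b / (18 * \<delta>)))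
                        (ereal (1 / (4 * \<mu> + sqrt (6 * (L\<^sup>2 + \<delta> / real b)))))"
  shows "integrable M
           (\<lambda>\<omega>. (norm (iseg G b \<gamma>1 \<gamma>2 x0 (\<lambda>j k i. \<xi> j k i \<omega>) K - xs))\<^sup>2) \<and>
         (\<integral>\<omega>. (norm (iseg G b \<gamma>1 \<gamma>2 x0 (\<lambda>j k i. \<xi> j k i \<omega>) K - xs))\<^sup>2 \<partial>M)
           \<le> (1 - \<alpha> * \<gamma> * \<mu> / 8) ^ K * (norm (x0 - xs))\<^sup>2
             + 48 * (\<alpha> + 1) * \<gamma> * \<sigma>\<^sup>2 / (\<mu> * real b)"
proof -
  interpret prob_space M by fact
  note lip = \<open>L-lipschitz_on UNIV F\<close>
    and est = \<open>stochastic_estimator D G F xs \<delta> \<sigma>\<close>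
    and pos = \<open>\<mu> > 0\<close> \<open>\<gamma> > 0\<close> \<open>0 < \<alpha>\<close> \<open>\<alpha> \<le> 1 / 4\<close> \<open>\<delta> \<ge> 0\<close> \<open>b \<ge> 1\<close>
  have \<gamma>12: "\<gamma>1 = \<gamma>" "\<gamma>2 = \<alpha> * \<gamma>"
    using \<open>\<gamma>1 = \<gamma>\<close> \<open>\<gamma>2 = \<alpha> * \<gamma>1\<close> by auto
  have mon: "F x \<bullet> (x - xs) \<ge> \<mu> * (norm (x - xs))\<^sup>2" for x
    using \<open>quasi_strongly_monotone \<mu> F xs\<close> by (simp add: quasi_strongly_monotone_def)
  have G: "(\<lambda>(s, x). G s x) \<in> borel_measurable (D \<Otimes>\<^sub>M borel)"
    using est by (simp add: stochastic_estimator_def)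
  have ind: "indep_vars (\<lambda>_. D) (\<lambda>(j, k, i). \<xi> j k i) ({1, 2} \<times> UNIV \<times> {1..b})"
    and law: "\<And>j k i. j \<in> {1, 2} \<Longrightarrow> i \<in> {1..b} \<Longrightarrow> distr M D (\<xi> j k i) = D"
    using \<open>iid_samples M D b \<xi>\<close> by (auto simp: iid_samples_def)

  note bounds = step_size_bounds[OF \<open>\<gamma> > 0\<close> \<open>\<mu> > 0\<close> \<open>\<delta> \<ge> 0\<close> \<open>b \<ge> 1\<close> assms(17)]
  define X where "X k \<omega> = iseg G b \<gamma>1 \<gamma>2 x0 (\<lambda>j k i. \<xi> j k i \<omega>) k" for k \<omega>
  define N where "N = Pi\<^sub>M {1..b} (\<lambda>_. D)"
  define Z where "Z j k \<omega> = (\<lambda>i\<in>{1..b}. \<xi> j k i \<omega>)" for j k \<omega>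
  have indep: "indep_rv borel (X k) N (Z 1 k)"
    "indep_rv (borel \<Otimes>\<^sub>M N) (\<lambda>\<omega>. (X k \<omega>, Z 1 k \<omega>)) N (Z 2 k)" for k
    unfolding X_def[abs_def] N_def Z_def[abs_def] by (rule iseg_indep_batches[OF G ind])+
  have H: "(\<lambda>(z, x). minibatch G b z x) \<in> borel_measurable (N \<Otimes>\<^sub>M borel)"
    unfolding case_prod_beta N_def
    by (intro minibatch_measurable[OF G] measurable_compose[OF measurable_fst measurable_component_singleton])
      auto
  have mb: "minibatch G b (Z j k \<omega>) = minibatch G b (\<lambda>i. \<xi> j k i \<omega>)" for j k \<omega>
    unfolding Z_def by (rule minibatch_cong) simp
  note moments = minibatch_moments[OF est \<open>b \<ge> 1\<close> indep_vars_batch[OF ind] law, folded mb]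

  let ?\<rho> = "1 - \<alpha> * \<gamma> * \<mu> / 8"
  let ?C = "\<alpha> * \<gamma>\<^sup>2 * (2 + \<alpha>) * (\<sigma>\<^sup>2 / real b)"
  let ?S = "8 * (2 + \<alpha>) * \<gamma> * \<sigma>\<^sup>2 / (\<mu> * real b)"
  have "\<alpha> * (\<gamma> * \<mu>) \<le> 1 / 4 * (1 / 4)"
    using pos bounds(2) by (intro mult_mono) auto
  then have \<rho>: "?\<rho> \<ge> 0"
    by (simp add: mult.assoc)
  have C: "?C \<ge> 0" and S: "?S \<ge> 0"
    using pos by simp_all
  \<comment> \<open>\<open>?S\<close> is the limit \<open>?C / (1 - ?\<rho>)\<close> of the recursion \<open>e \<mapsto> ?\<rho> * e + ?C\<close>.\<close>
  have fixpoint: "?\<rho> * ?S + ?C = ?S"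
    using pos by (simp add: field_simps power2_eq_square)
  have step: "(\<integral>\<^sup>+\<omega>. ennreal ((norm (X (Suc k) \<omega> - xs))\<^sup>2) \<partial>M)
      \<le> ennreal ?\<rho> * (\<integral>\<^sup>+\<omega>. ennreal ((norm (X k \<omega> - xs))\<^sup>2) \<partial>M) + ennreal ?C" for k
  proof -
    have X_Suc: "X (Suc k) \<omega> = X k \<omega> - (\<alpha> * \<gamma>) *\<^sub>R
        minibatch G b (Z 2 k \<omega>) (X k \<omega> - \<gamma> *\<^sub>R minibatch G b (Z 1 k \<omega>) (X k \<omega>))" for \<omega>
      by (simp add: X_def mb \<gamma>12 Let_def)
    show ?thesis
      unfolding X_Suc
      by (rule extragradient_expected_step[OF H indep, where \<delta> = "\<delta> / real b" and F = F and L = L])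
        (use moments mon lip pos bounds in auto)
  qed
  have bound: "(\<integral>\<^sup>+\<omega>. ennreal ((norm (X k \<omega> - xs))\<^sup>2) \<partial>M) \<le> ennreal (?\<rho> ^ k * (norm (x0 - xs))\<^sup>2 + ?S)" for k
  proof (induction k)
    case 0
    show ?case
      using S by (simp add: X_def emeasure_space_1 ennreal_leI)
  next
    case (Suc k)
    let ?R = "?\<rho> ^ k * (norm (x0 - xs))\<^sup>2"
    have "(\<integral>\<^sup>+\<omega>. ennreal ((norm (X (Suc k) \<omega> - xs))\<^sup>2) \<partial>M) \<le> ennreal ?\<rho> * ennreal (?R + ?S) + ennreal ?C"
      using step[of k] Suc.IH by (meson add_right_mono mult_left_mono order_trans zero_le)
    also have "\<dots> = ennreal (?\<rho> * (?R + ?S) + ?C)"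
      using \<rho> C S by (simp add: ennreal_mult'' ennreal_plus del: ennreal_plus_if)
    also have "?\<rho> * (?R + ?S) + ?C = ?\<rho> ^ Suc k * (norm (x0 - xs))\<^sup>2 + (?\<rho> * ?S + ?C)"
      by (simp add: distrib_left mult.assoc)
    finally show ?case
      unfolding fixpoint .
  qed
  have meas: "(\<lambda>\<omega>. (norm (X K \<omega> - xs))\<^sup>2) \<in> borel_measurable M"
    using indep(1)[of K] unfolding indep_rv_def by auto
  have int: "integrable M (\<lambda>\<omega>. (norm (X K \<omega> - xs))\<^sup>2)"
    using bound[of K] meas by (intro integrableI_nonneg) (auto intro: le_less_trans)
  have "ennreal (expectation (\<lambda>\<omega>. (norm (X K \<omega> - xs))\<^sup>2)) \<le> ennreal (?\<rho> ^ K * (norm (x0 - xs))\<^sup>2 + ?S)"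
    using bound[of K] int by (subst nn_integral_eq_integral[symmetric]) auto
  then have "expectation (\<lambda>\<omega>. (norm (X K \<omega> - xs))\<^sup>2) \<le> ?\<rho> ^ K * (norm (x0 - xs))\<^sup>2 + ?S"
    using \<rho> S by (subst (asm) ennreal_le_iff) (auto intro!: add_nonneg_nonneg)
  also have "?S \<le> 48 * (\<alpha> + 1) * \<gamma> * \<sigma>\<^sup>2 / (\<mu> * real b)"
    using pos by (intro divide_right_mono mult_right_mono) auto
  finally show ?thesis
    using int unfolding X_def by simp
qed

end
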